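(* Let $X$ and $Y$ be infinite Tychonoff spaces. Then $C_p(X\times Y)$ is linearly homeomorphic to the product $C_p(X\times Y)\times\mathbb{R}$.
   Context: For a Tychonoff space $Z$, $C_p(Z)$ is the vector space of all continuous real-valued functions on $Z$ with the topology of pointwise convergence. *)

theory Defs
  imports "HOL-Analysis.Analysis"
begin

definition Tychonoff_space :: "'a topology \<Rightarrow> bool" where
  "Tychonoff_space X \<longleftrightarrow> completely_regular_space X \<and> Hausdorff_space X"

text \<open>
  A real vector space with a topology on an explicit carrier, which is the
  topspace of the topology. An explicit structure is needed because the carrier
  of $C_p(Z)$ depends on the topology of $Z$ and is not a type.
\<close>

record 'v real_tvs =
  tvs_topology :: "'v topology"
  tvs_add :: "'v \<Rightarrow> 'v \<Rightarrow> 'v"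
  tvs_scale :: "real \<Rightarrow> 'v \<Rightarrow> 'v"

definition linearly_homeomorphic :: "'v real_tvs \<Rightarrow> 'w real_tvs \<Rightarrow> bool" where
  "linearly_homeomorphic V W \<longleftrightarrow>
     (\<exists>h. homeomorphic_map (tvs_topology V) (tvs_topology W) h \<and>
          (\<forall>u \<in> topspace (tvs_topology V). \<forall>v \<in> topspace (tvs_topology V).
             h (tvs_add V u v) = tvs_add W (h u) (h v)) \<and>
          (\<forall>c. \<forall>v \<in> topspace (tvs_topology V).
             h (tvs_scale V c v) = tvs_scale W c (h v)))"

definition tvs_real :: "real real_tvs" where
  "tvs_real = \<lparr>tvs_topology = euclideanreal, tvs_add = (+), tvs_scale = (*)\<rparr>"

definition tvs_prod :: "'v real_tvs \<Rightarrow> 'w real_tvs \<Rightarrow> ('v \<times> 'w) real_tvs" where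
  "tvs_prod V W =
     \<lparr>tvs_topology = prod_topology (tvs_topology V) (tvs_topology W),
      tvs_add = (\<lambda>p q. (tvs_add V (fst p) (fst q), tvs_add W (snd p) (snd q))),
      tvs_scale = (\<lambda>c p. (tvs_scale V c (fst p), tvs_scale W c (snd p)))\<rparr>"

text \<open>
  Real-valued functions on \<open>Z\<close> are represented, as in the library's product
  topology, by functions that are \<open>undefined\<close> off \<open>topspace Z\<close>; hence the
  restrictions in the pointwise operations.
\<close>

definition Cp :: "'a topology \<Rightarrow> ('a \<Rightarrow> real) real_tvs" where
  "Cp Z =
     \<lparr>tvs_topology =
        subtopology (product_topology (\<lambda>_. euclideanreal) (topspace Z))
                    {f. continuous_map Z euclideanreal f},
      tvs_add = (\<lambda>f g. \<lambda>z \<in> topspace Z. f z + g z),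
      tvs_scale = (\<lambda>c f. \<lambda>z \<in> topspace Z. c * f z)\<rparr>"

lemma topspace_Cp:
  "topspace (tvs_topology (Cp Z)) =
     {f \<in> extensional (topspace Z). continuous_map Z euclideanreal f}"
  by (auto simp: Cp_def PiE_def)

end

theory Submission
  imports Defs
begin

text \<open>
  It suffices to find finitely supported functionals \<open>\<mu> n\<close> and functions \<open>e n\<close> with
  disjoint supports, biorthogonal to each other, such that every sequence \<open>(\<mu> n f)\<close>
  lies in a shift-invariant class \<open>P\<close> of sequences \<open>a\<close> for which \<open>\<Sum>n. a n * e n\<close>
  is continuous: then \<open>f\<close> can be modified so that its coefficients \<open>\<mu> n f\<close> are shifted
  by one place, and the coefficient shifted out is the factor \<open>\<real>\<close>.

  If \<open>X \<times> Y\<close> carries an infinite discrete family of nonempty open sets, take point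
  evaluations, and all sequences for \<open>P\<close>. Otherwise every continuous \<open>f\<close> on \<open>X \<times> Y\<close> is
  bounded and its sections \<open>f (x, _)\<close> form a totally bounded set in the supremum norm.
  Take points \<open>a i\<close> in \<open>X\<close> and \<open>b s\<close> in \<open>Y\<close>, for \<open>i < n\<close> and \<open>s \<subseteq> {..<n}\<close>, and let
  \<open>\<mu> n\<close> be the average of the point masses at \<open>(a i, b s)\<close> with signs
  \<open>\<plusminus>1\<close> according to whether \<open>i \<in> s\<close>. By orthogonality of the signs \<open>\<mu> n\<close> is
  \<open>O(1 / sqrt n)\<close> on products \<open>g x * h y\<close> of bounded functions, so by total boundedness
  \<open>\<mu> n f\<close> tends to 0 for all \<open>f\<close>, and \<open>P\<close> can be the class of null sequences.
\<close>

section \<open>Shifting coefficients\<close>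

lemma continuous_map_into_Cp:
  assumes "\<And>t. t \<in> topspace T \<Longrightarrow> \<phi> t \<in> topspace (tvs_topology (Cp Z))"
    and "\<And>z. z \<in> topspace Z \<Longrightarrow> continuous_map T euclideanreal (\<lambda>t. \<phi> t z)"
  shows "continuous_map T (tvs_topology (Cp Z)) \<phi>"
proof -
  have "continuous_map T (product_topology (\<lambda>_. euclideanreal) (topspace Z)) \<phi>"
    using assms by (auto simp: continuous_map_componentwise topspace_Cp)
  then show ?thesis
    using assms(1) by (auto simp: Cp_def continuous_map_in_subtopology)
qed

lemma continuous_map_Cp_eval:
  assumes "z \<in> topspace Z"
  shows "continuous_map (tvs_topology (Cp Z)) euclideanreal (\<lambda>f. f z)"
  using assms unfolding Cp_def
  by (auto intro: continuous_map_from_subtopology continuous_map_product_projection)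

text \<open>Where at most one \<open>e n\<close> is nonzero, this is the pointwise sum over all
  \<open>n\<close>. The index set depends on \<open>z\<close> but not on \<open>a\<close>, so the
  value is linear in \<open>a\<close> at every point, even where the set is infinite and the sum
  takes its default value 0.\<close>

definition disjoint_series :: "(nat \<Rightarrow> 'c \<Rightarrow> real) \<Rightarrow> (nat \<Rightarrow> real) \<Rightarrow> 'c \<Rightarrow> real" where
  "disjoint_series e a z = (\<Sum>n | e n z \<noteq> 0. a n * e n z)"

lemma disjoint_series_add:
  "disjoint_series e (\<lambda>n. a n + b n) z = disjoint_series e a z + disjoint_series e b z"
  by (simp add: disjoint_series_def sum.distrib algebra_simps)

lemma disjoint_series_diff:
  "disjoint_series e (\<lambda>n. a n - b n) z = disjoint_series e a z - disjoint_series e b z"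
  by (simp add: disjoint_series_def sum_subtractf algebra_simps)

lemma disjoint_series_cmult:
  "disjoint_series e (\<lambda>n. c * a n) z = c * disjoint_series e a z"
  by (simp add: disjoint_series_def sum_distrib_left algebra_simps)

lemma disjoint_series_eq:
  assumes "\<And>m. m \<noteq> n \<Longrightarrow> e m z = 0"
  shows "disjoint_series e a z = a n * e n z"
proof -
  have "disjoint_series e a z = (\<Sum>m\<in>{n}. a m * e m z)"
    unfolding disjoint_series_def using assms
    by (intro sum.mono_neutral_left) auto
  then show ?thesis by simp
qed

text \<open>The functional with index \<open>n\<close> has the mass \<open>w n z\<close> at each
  \<open>z\<close> in \<open>F n\<close>. By \<open>e_off\<close> and \<open>normalised\<close> it
  takes the value 1 at \<open>e n\<close> and 0 at every other \<open>e m\<close>. Disjointness of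
  supports is demanded only on the sets \<open>F n\<close>; continuity of the series elsewhere is
  left to \<open>P_series\<close>.\<close>

locale biorthogonal_system =
  fixes Z :: "'c topology" and e :: "nat \<Rightarrow> 'c \<Rightarrow> real"
    and F :: "nat \<Rightarrow> 'c set" and w :: "nat \<Rightarrow> 'c \<Rightarrow> real"
    and P :: "(nat \<Rightarrow> real) \<Rightarrow> bool"
  assumes F_sub: "F n \<subseteq> topspace Z"
    and e_off: "\<lbrakk>z \<in> F n; m \<noteq> n\<rbrakk> \<Longrightarrow> e m z = 0"
    and normalised: "(\<Sum>z\<in>F n. w n z * e n z) = 1"
    and P_series: "P a \<Longrightarrow> continuous_map Z euclideanreal (disjoint_series e a)"
    and P_shift: "P a \<Longrightarrow> P (\<lambda>n. a (Suc n))"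
    and P_unshift: "P a \<Longrightarrow> P (case_nat t a)"
    and P_functionals: "continuous_map Z euclideanreal f \<Longrightarrow> P (\<lambda>n. \<Sum>z\<in>F n. w n z * f z)"
begin

definition mu :: "('c \<Rightarrow> real) \<Rightarrow> nat \<Rightarrow> real" where
  "mu f n = (\<Sum>z\<in>F n. w n z * f z)"

lemma mu_restrict [simp]: "mu (restrict f (topspace Z)) = mu f"
  unfolding mu_def fun_eq_iff using F_sub by (intro allI sum.cong) auto

lemma mu_add: "mu (\<lambda>z. f z + g z) n = mu f n + mu g n"
  by (simp add: mu_def sum.distrib algebra_simps)

lemma mu_cmult: "mu (\<lambda>z. c * f z) n = c * mu f n"
  by (simp add: mu_def sum_distrib_left algebra_simps)

text \<open>On \<open>F n\<close> the series consists of its term \<open>n\<close> alone, so the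
  identity is purely algebraic and holds for every sequence \<open>a\<close>, in \<open>P\<close> or
  not.\<close>

lemma mu_series [simp]: "mu (disjoint_series e a) n = a n"
proof -
  have "mu (disjoint_series e a) n = (\<Sum>z\<in>F n. a n * (w n z * e n z))"
    unfolding mu_def
    by (rule sum.cong) (auto simp: disjoint_series_eq [where n = n] e_off)
  also have "\<dots> = a n"
    by (simp add: normalised flip: sum_distrib_left)
  finally show ?thesis .
qed

lemma P_mu: "continuous_map Z euclideanreal f \<Longrightarrow> P (mu f)"
  using P_functionals by (simp add: mu_def [abs_def])

text \<open>The function \<open>f\<close> with its coefficients \<open>mu f\<close> exchanged for
  \<open>a\<close>; the remainder of \<open>f\<close>, on which all functionals vanish, stays as it
  is.\<close>

definition replace :: "('c \<Rightarrow> real) \<Rightarrow> (nat \<Rightarrow> real) \<Rightarrow> 'c \<Rightarrow> real" where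
  "replace f a = (\<lambda>z\<in>topspace Z. f z + disjoint_series e (\<lambda>n. a n - mu f n) z)"

lemma mu_replace [simp]: "mu (replace f a) = a"
  by (simp add: replace_def mu_add fun_eq_iff)

text \<open>The result depends on the function only through its remainder after subtracting the
  series of its coefficients, and a first replacement does not change that remainder.\<close>

lemma replace_replace [simp]: "replace (replace f a) b = replace f b"
proof
  fix z
  show "replace (replace f a) b z = replace f b z"
    unfolding replace_def [of "replace f a"]
    by (simp add: disjoint_series_diff) (simp add: replace_def disjoint_series_diff)
qed

lemma replace_mu:
  assumes "f \<in> extensional (topspace Z)"
  shows "replace f (mu f) = f"
  using assms by (auto simp: replace_def disjoint_series_def extensional_def fun_eq_iff)

lemma replace_in_Cp:
  assumes "continuous_map Z euclideanreal f" "P a"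
  shows "replace f a \<in> topspace (tvs_topology (Cp Z))"
proof -
  \<comment> \<open>The two series are kept apart because \<open>P\<close> is known for
    \<open>a\<close> and for \<open>mu f\<close>, not for their difference.\<close>
  have "continuous_map Z euclideanreal
      (\<lambda>z. f z + (disjoint_series e a z - disjoint_series e (mu f) z))"
    using assms P_series [OF P_mu] P_series by (intro continuous_intros) auto
  then have "continuous_map Z euclideanreal (replace f a)"
    by (rule continuous_map_eq) (simp add: replace_def disjoint_series_diff)
  then show ?thesis by (simp add: topspace_Cp replace_def)
qed

lemma continuous_map_mu:
  "continuous_map (tvs_topology (Cp Z)) euclideanreal (\<lambda>f. mu f n)"
proof -
  have "continuous_map (tvs_topology (Cp Z)) euclideanreal (\<lambda>f. w n z * f z)" if "z \<in> F n" for z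
    using that F_sub by (intro continuous_intros continuous_map_Cp_eval) auto
  then show ?thesis
    unfolding mu_def
    by (cases "finite (F n)") (auto intro: continuous_map_sum)
qed

text \<open>The topology is pointwise, and at a fixed \<open>z\<close> the correction is a sum over
  \<open>{n. e n z \<noteq> 0}\<close>, which does not vary with \<open>t\<close>: either a finite
  sum of functions continuous in \<open>t\<close>, or constantly 0.\<close>

lemma continuous_map_replace:
  assumes "continuous_map T (tvs_topology (Cp Z)) \<phi>"
    and "\<And>t. t \<in> topspace T \<Longrightarrow> P (\<alpha> t)"
    and "\<And>n. continuous_map T euclideanreal (\<lambda>t. \<alpha> t n)"
  shows "continuous_map T (tvs_topology (Cp Z)) (\<lambda>t. replace (\<phi> t) (\<alpha> t))"
proof (rule continuous_map_into_Cp)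
  fix t assume t: "t \<in> topspace T"
  then have "\<phi> t \<in> topspace (tvs_topology (Cp Z))"
    using assms(1) by (auto simp: continuous_map_def)
  with t show "replace (\<phi> t) (\<alpha> t) \<in> topspace (tvs_topology (Cp Z))"
    by (intro replace_in_Cp assms) (auto simp: topspace_Cp)
next
  fix z assume z: "z \<in> topspace Z"
  have ev: "continuous_map T euclideanreal (\<lambda>t. \<phi> t z)"
    using continuous_map_compose [OF assms(1) continuous_map_Cp_eval [OF z]] by (simp add: o_def)
  have "continuous_map T euclideanreal (\<lambda>t. mu (\<phi> t) n)" for n
    using continuous_map_compose [OF assms(1) continuous_map_mu] by (simp add: o_def)
  then have "continuous_map T euclideanreal (\<lambda>t. (\<alpha> t n - mu (\<phi> t) n) * e n z)" for n
    by (intro continuous_intros assms)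
  then have "continuous_map T euclideanreal
      (\<lambda>t. disjoint_series e (\<lambda>n. \<alpha> t n - mu (\<phi> t) n) z)"
    unfolding disjoint_series_def
    by (cases "finite {n. e n z \<noteq> 0}") (auto intro: continuous_map_sum)
  with z ev show "continuous_map T euclideanreal (\<lambda>t. replace (\<phi> t) (\<alpha> t) z)"
    unfolding replace_def by (simp add: continuous_map_add)
qed

text \<open>A Hilbert hotel argument: \<open>h\<close> splits off the coefficient 0 and moves the
  others down by one place, and \<open>k\<close> moves them up again and puts the real number in the
  vacant place 0.\<close>

lemma linearly_homeomorphic_prod_real:
  "linearly_homeomorphic (Cp Z) (tvs_prod (Cp Z) tvs_real)"
proof -
  define h where "h f = (replace f (\<lambda>n. mu f (Suc n)), mu f 0)" for f
  define k where "k p = replace (fst p) (case_nat (snd p) (mu (fst p)))" for p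
  let ?C = "tvs_topology (Cp Z)"
  let ?R = "euclideanreal"
  have C: "continuous_map Z euclideanreal f \<and> f \<in> extensional (topspace Z)" if "f \<in> topspace ?C" for f
    using that by (simp add: topspace_Cp)
  have "homeomorphic_maps ?C (prod_topology ?C ?R) h k"
    unfolding homeomorphic_maps_def
  proof (intro conjI ballI)
    show "continuous_map ?C (prod_topology ?C ?R) h"
      unfolding h_def
      using C by (intro continuous_map_pairedI continuous_map_replace continuous_map_mu
          P_shift P_mu) auto
    have fst: "continuous_map (prod_topology ?C ?R) ?C fst"
      by (rule continuous_map_fst)
    show "continuous_map (prod_topology ?C ?R) ?C k"
      unfolding k_def
    proof (intro continuous_map_replace fst P_unshift P_mu)
      show "continuous_map (prod_topology ?C ?R) ?R (\<lambda>p. case_nat (snd p) (mu (fst p)) n)" for n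
        using continuous_map_compose [OF fst continuous_map_mu]
        by (cases n) (simp_all add: o_def continuous_map_snd)
    qed (use C in auto)
  next
    fix f assume "f \<in> topspace ?C"
    moreover have "case_nat (mu f 0) (\<lambda>n. mu f (Suc n)) = mu f"
      by (simp add: fun_eq_iff split: nat.split)
    ultimately show "k (h f) = f"
      using C by (simp add: h_def k_def replace_mu)
  next
    fix p assume "p \<in> topspace (prod_topology ?C ?R)"
    then have "fst p \<in> topspace ?C" by auto
    then show "h (k p) = p"
      using C by (simp add: h_def k_def replace_mu)
  qed
  moreover have "h (tvs_add (Cp Z) f g) = tvs_add (tvs_prod (Cp Z) tvs_real) (h f) (h g)" for f g
    by (auto simp: h_def tvs_prod_def Cp_def tvs_real_def replace_def mu_add fun_eq_iff
        disjoint_series_diff disjoint_series_add)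
  moreover have "h (tvs_scale (Cp Z) c f) = tvs_scale (tvs_prod (Cp Z) tvs_real) c (h f)" for c f
    by (auto simp: h_def tvs_prod_def Cp_def tvs_real_def replace_def mu_cmult fun_eq_iff
        disjoint_series_diff disjoint_series_cmult algebra_simps)
  moreover have "tvs_topology (tvs_prod (Cp Z) tvs_real) = prod_topology ?C ?R"
    by (simp add: tvs_prod_def tvs_real_def)
  ultimately show ?thesis
    unfolding linearly_homeomorphic_def homeomorphic_map_maps
    by metis
qed

end

section \<open>Discrete sequences of open sets and bump functions\<close>

lemma continuous_map_real_iff:
  fixes f :: "'c \<Rightarrow> real"
  shows "continuous_map Z euclideanreal f \<longleftrightarrow>
    (\<forall>z\<in>topspace Z. \<forall>\<epsilon>>0. \<exists>U. openin Z U \<and> z \<in> U \<and> (\<forall>w\<in>U. \<bar>f w - f z\<bar> < \<epsilon>))"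
  using Met_TC.continuous_map_to_metric [of Z f]
  by (simp add: dist_real_def abs_minus_commute)

lemma completely_regular_bump:
  assumes "completely_regular_space X" "openin X U" "x \<in> U"
  obtains \<phi> :: "'a \<Rightarrow> real" where "continuous_map X euclideanreal \<phi>" "\<phi> x = 1"
    "\<And>z. z \<in> topspace X \<Longrightarrow> 0 \<le> \<phi> z \<and> \<phi> z \<le> 1"
    "\<And>z. \<lbrakk>z \<in> topspace X; z \<notin> U\<rbrakk> \<Longrightarrow> \<phi> z = 0"
proof -
  have "closedin X (topspace X - U)" "x \<in> topspace X - (topspace X - U)"
    using assms openin_subset by auto
  then obtain f :: "'a \<Rightarrow> real" where f: "continuous_map X (top_of_set {0..1}) f" "f x = 0"
      "f ` (topspace X - U) \<subseteq> {1}"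
    using assms(1) unfolding completely_regular_space_def by meson
  show thesis
  proof
    show "continuous_map X euclideanreal (\<lambda>z. 1 - f z)"
      using f(1) by (intro continuous_intros) (simp add: continuous_map_in_subtopology)
    show "0 \<le> 1 - f z \<and> 1 - f z \<le> 1" if "z \<in> topspace X" for z
      using f(1) that by (auto simp: continuous_map_in_subtopology)
    show "1 - f z = 0" if "z \<in> topspace X" "z \<notin> U" for z
      using f(3) that by auto
  qed (use f in auto)
qed

text \<open>Every point has a neighbourhood meeting at most one member. In particular the members
  are pairwise disjoint.\<close>

definition discrete_sequence :: "'c topology \<Rightarrow> (nat \<Rightarrow> 'c set) \<Rightarrow> bool" where
  "discrete_sequence Z G \<longleftrightarrow> (\<forall>n. openin Z (G n) \<and> G n \<noteq> {}) \<and>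
     (\<forall>z\<in>topspace Z. \<exists>U. openin Z U \<and> z \<in> U \<and>
        (\<forall>m n. m < n \<longrightarrow> U \<inter> G m = {} \<or> U \<inter> G n = {}))"

lemma discrete_sequence_imp_linearly_homeomorphic:
  assumes "completely_regular_space Z" "discrete_sequence Z G"
  shows "linearly_homeomorphic (Cp Z) (tvs_prod (Cp Z) tvs_real)"
proof -
  have "\<forall>n. \<exists>z. z \<in> G n"
    using assms(2) by (auto simp: discrete_sequence_def)
  then obtain p where p: "\<And>n. p n \<in> G n" by metis
  have op: "openin Z (G n)" for n
    using assms(2) by (auto simp: discrete_sequence_def)
  have "\<forall>n. \<exists>\<phi>. continuous_map Z euclideanreal \<phi> \<and> \<phi> (p n) = 1 \<and>
      (\<forall>z. z \<in> topspace Z \<longrightarrow> z \<notin> G n \<longrightarrow> \<phi> z = 0)"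
    by (blast intro: completely_regular_bump [OF assms(1) op p])
  from choice [OF this] obtain e where cont: "\<And>n. continuous_map Z euclideanreal (e n)"
    and e1: "\<And>n. e n (p n) = 1" and e0: "\<And>n z. \<lbrakk>z \<in> topspace Z; z \<notin> G n\<rbrakk> \<Longrightarrow> e n z = 0"
    by blast
  \<comment> \<open>Discreteness in the form used below: on \<open>U\<close> all bumps vanish except
    possibly the one with index \<open>n\<close>, which is arbitrary if \<open>U\<close> meets no
    member.\<close>
  have local: "\<exists>U n. openin Z U \<and> z \<in> U \<and> (\<forall>m w. m \<noteq> n \<longrightarrow> w \<in> U \<longrightarrow> w \<notin> G m)"
    if "z \<in> topspace Z" for z
  proof -
    have "\<exists>U. openin Z U \<and> z \<in> U \<and> (\<forall>m n. m < n \<longrightarrow> U \<inter> G m = {} \<or> U \<inter> G n = {})"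
      using assms(2) that by (simp add: discrete_sequence_def)
    then obtain U where U: "openin Z U" "z \<in> U"
        and lt: "\<forall>m n. m < n \<longrightarrow> U \<inter> G m = {} \<or> U \<inter> G n = {}"
      by (elim exE conjE)
    have "m = n" if "U \<inter> G m \<noteq> {}" "U \<inter> G n \<noteq> {}" for m n
      using that lt [rule_format, of m n] lt [rule_format, of n m] by linarith
    then have "\<exists>n. \<forall>m w. m \<noteq> n \<longrightarrow> w \<in> U \<longrightarrow> w \<notin> G m" by blast
    with U show ?thesis by blast
  qed
  have p_off: "p n \<notin> G m" if "m \<noteq> n" for m n
  proof -
    have "p n \<in> topspace Z" using p op openin_subset by blast
    with local [of "p n"] obtain k where k: "\<And>m. m \<noteq> k \<Longrightarrow> p n \<notin> G m" by blast
    then show ?thesis using p that by metis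
  qed
  \<comment> \<open>The functionals are evaluations at the points \<open>p n\<close>. Every sequence
    is admissible, since near each point the series has a single active term.\<close>
  interpret biorthogonal_system Z e "\<lambda>n. {p n}" "\<lambda>n z. 1" "\<lambda>_. True"
  proof
    show "{p n} \<subseteq> topspace Z" for n
      using p op openin_subset by blast
    then show "e m z = 0" if "z \<in> {p n}" "m \<noteq> n" for z n m
      using that e0 p_off by auto
    show "continuous_map Z euclideanreal (disjoint_series e a)" for a
      unfolding continuous_map_real_iff
    proof (intro ballI allI impI)
      fix z and \<epsilon> :: real
      assume z: "z \<in> topspace Z" and "\<epsilon> > 0"
      obtain U n where U: "openin Z U" "z \<in> U" and off: "\<And>m w. \<lbrakk>m \<noteq> n; w \<in> U\<rbrakk> \<Longrightarrow> w \<notin> G m"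
        using local [OF z] by blast
      have eq: "disjoint_series e a w = a n * e n w" if "w \<in> U" for w
        using that off e0 openin_subset [OF U(1)] by (intro disjoint_series_eq) blast
      have "continuous_map Z euclideanreal (\<lambda>w. a n * e n w)"
        by (intro continuous_intros cont)
      then obtain V where "openin Z V" "z \<in> V" "\<forall>w\<in>V. \<bar>a n * e n w - a n * e n z\<bar> < \<epsilon>"
        using z \<open>\<epsilon> > 0\<close> unfolding continuous_map_real_iff by meson
      then show "\<exists>U. openin Z U \<and> z \<in> U \<and>
          (\<forall>w\<in>U. \<bar>disjoint_series e a w - disjoint_series e a z\<bar> < \<epsilon>)"
        using U by (intro exI [of _ "U \<inter> V"]) (auto simp: eq)
    qed
  qed (use e1 in auto)
  show ?thesis by (rule linearly_homeomorphic_prod_real)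
qed

text \<open>The partial sums converge uniformly: at each point only one term survives, so the tail
  from \<open>N\<close> on is bounded by the values of \<open>\<bar>a n\<bar>\<close> with
  \<open>n \<ge> N\<close>.\<close>

lemma continuous_map_disjoint_series:
  assumes cont: "\<And>n. continuous_map Z euclideanreal (e n)"
    and le1: "\<And>n z. z \<in> topspace Z \<Longrightarrow> \<bar>e n z\<bar> \<le> 1"
    and disj: "\<And>z. z \<in> topspace Z \<Longrightarrow> \<exists>n. \<forall>m. m \<noteq> n \<longrightarrow> e m z = 0"
    and a: "a \<longlonglongrightarrow> (0::real)"
  shows "continuous_map Z euclideanreal (disjoint_series e a)"
  unfolding continuous_map_real_iff
proof (intro ballI allI impI)
  fix z and \<epsilon> :: real
  assume z: "z \<in> topspace Z" and "\<epsilon> > 0"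
  then obtain N where N: "\<And>n. n \<ge> N \<Longrightarrow> \<bar>a n\<bar> < \<epsilon> / 3"
    using LIMSEQ_D [OF a, of "\<epsilon> / 3"] by auto
  let ?g = "\<lambda>z. \<Sum>n<N. a n * e n z"
  have approx: "\<bar>disjoint_series e a w - ?g w\<bar> < \<epsilon> / 3" if w: "w \<in> topspace Z" for w
  proof -
    obtain n where n: "\<And>m. m \<noteq> n \<Longrightarrow> e m w = 0"
      using disj [OF w] by blast
    then have eq: "disjoint_series e a w = a n * e n w"
      by (rule disjoint_series_eq)
    show ?thesis
    proof (cases "n < N")
      case True
      have "?g w = (\<Sum>m\<in>{n}. a m * e m w)"
        using n True by (intro sum.mono_neutral_right) auto
      then show ?thesis using eq \<open>\<epsilon> > 0\<close> by simp
    next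
      case False
      then have "?g w = 0"
        using n by (intro sum.neutral) auto
      moreover have "\<bar>a n * e n w\<bar> \<le> \<bar>a n\<bar>"
        using le1 [OF w, of n] by (simp add: abs_mult mult_left_le)
      ultimately show ?thesis using eq N [of n] False by auto
    qed
  qed
  have "continuous_map Z euclideanreal ?g"
    by (intro continuous_intros cont) auto
  then obtain V where V: "openin Z V" "z \<in> V" "\<forall>w\<in>V. \<bar>?g w - ?g z\<bar> < \<epsilon> / 3"
    using z \<open>\<epsilon> > 0\<close> unfolding continuous_map_real_iff by (meson divide_pos_pos zero_less_numeral)
  have "\<bar>disjoint_series e a w - disjoint_series e a z\<bar> < \<epsilon>" if "w \<in> V" for w
  proof -
    have "w \<in> topspace Z" using V that openin_subset by blast
    moreover have "\<bar>?g w - ?g z\<bar> < \<epsilon> / 3" using V(3) that by blast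
    ultimately show ?thesis using approx [of w] approx [OF z] by linarith
  qed
  with V show "\<exists>U. openin Z U \<and> z \<in> U \<and>
      (\<forall>w\<in>U. \<bar>disjoint_series e a w - disjoint_series e a z\<bar> < \<epsilon>)"
    by blast
qed

text \<open>Separate two points of \<open>W\<close> by \<open>A\<close> and \<open>B\<close>. If
  \<open>B \<inter> W\<close> is infinite, it serves as \<open>W'\<close> and
  \<open>A \<inter> W\<close> as \<open>U\<close>. If it is finite, it is closed; it then serves as
  \<open>U\<close>, and its complement in \<open>W\<close> is still open and infinite.\<close>

lemma infinite_Hausdorff_split:
  assumes H: "Hausdorff_space X" and W: "openin X W" "infinite W"
  shows "\<exists>U W'. openin X U \<and> U \<noteq> {} \<and> openin X W' \<and> infinite W' \<and>
    U \<subseteq> W \<and> W' \<subseteq> W \<and> U \<inter> W' = {}"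
proof -
  obtain p where p: "p \<in> W" using W(2) by (metis finite.emptyI equals0I)
  obtain q where q: "q \<in> W" "q \<noteq> p" using W(2)
    by (metis finite.emptyI finite_insert finite_subset insertI1 subsetI)
  have "p \<in> topspace X" "q \<in> topspace X" using p q W(1) openin_subset by auto
  then obtain A B where AB: "openin X A" "openin X B" "p \<in> A" "q \<in> B" "A \<inter> B = {}"
    using H q(2) unfolding Hausdorff_space_def disjnt_def by metis
  show ?thesis
  proof (cases "finite (B \<inter> W)")
    case False
    with AB W p show ?thesis
      by (intro exI [of _ "A \<inter> W"] exI [of _ "B \<inter> W"]) auto
  next
    case True
    have "B \<inter> W \<subseteq> topspace X" using W(1) openin_subset by auto
    with True H have "closedin X (B \<inter> W)"
      by (metis Hausdorff_imp_t1_space t1_space_closedin_finite)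
    with W have "openin X (W - B \<inter> W)" by (simp add: openin_diff)
    moreover have "infinite (W - B \<inter> W)" using True W(2) by (rule Diff_infinite_finite)
    ultimately show ?thesis
      using AB W q by (intro exI [of _ "B \<inter> W"] exI [of _ "W - B \<inter> W"]) auto
  qed
qed

lemma infinite_Hausdorff_disjoint_open:
  assumes H: "Hausdorff_space X" and inf: "infinite (topspace X)"
  obtains U :: "nat \<Rightarrow> 'a set" where "\<And>n. openin X (U n)" "\<And>n. U n \<noteq> {}"
    "\<And>m n. m \<noteq> n \<Longrightarrow> U m \<inter> U n = {}"
proof -
  \<comment> \<open>\<open>W\<close> is the infinite open reserve from which all later sets are
    taken; its disjointness from \<open>U\<close> makes the chosen sets pairwise disjoint.\<close>
  let ?P = "\<lambda>(U, W). openin X U \<and> U \<noteq> {} \<and> openin X W \<and> infinite W \<and> U \<inter> W = {}"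
  have "\<exists>s. \<forall>n. ?P (s n) \<and> fst (s (Suc n)) \<subseteq> snd (s n) \<and> snd (s (Suc n)) \<subseteq> snd (s n)"
  proof (rule dependent_nat_choice)
    show "\<exists>s. ?P s"
      using infinite_Hausdorff_split [OF H openin_topspace inf] by auto
    show "\<exists>t. ?P t \<and> fst t \<subseteq> snd s \<and> snd t \<subseteq> snd s" if "?P s" for s n
    proof -
      have "openin X (snd s)" "infinite (snd s)" using that by (auto simp: case_prod_beta)
      from infinite_Hausdorff_split [OF H this] show ?thesis by auto
    qed
  qed
  then obtain s where "\<forall>n. ?P (s n) \<and> fst (s (Suc n)) \<subseteq> snd (s n) \<and> snd (s (Suc n)) \<subseteq> snd (s n)"
    by (elim exE)
  then have s: "?P (s n)" "fst (s (Suc n)) \<subseteq> snd (s n)" "snd (s (Suc n)) \<subseteq> snd (s n)" for n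
    by (simp_all only:)
  have anti: "snd (s n) \<subseteq> snd (s m)" if "m \<le> n" for m n
    using s(3) that by (rule lift_Suc_antimono_le)
  have lt: "fst (s m) \<inter> fst (s n) = {}" if mn: "m < n" for m n
  proof -
    obtain k where k: "n = Suc k" "m \<le> k" using mn by (metis Suc_le_D Suc_le_eq not_less_eq_eq)
    moreover have "fst (s m) \<inter> snd (s m) = {}" using s(1) [of m] by (simp add: case_prod_beta)
    ultimately show ?thesis using s(2) [of k] anti [OF k(2)] unfolding k(1) by blast
  qed
  show thesis
  proof (rule that [of "\<lambda>n. fst (s n)"])
    show "fst (s m) \<inter> fst (s n) = {}" if "m \<noteq> n" for m n
      using lt [of m n] lt [of n m] that by (cases "m < n") auto
  qed (use s(1) in \<open>auto simp: case_prod_beta\<close>)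
qed

lemma disjoint_bumps:
  assumes "completely_regular_space X" "Hausdorff_space X" "infinite (topspace X)"
  obtains x :: "nat \<Rightarrow> 'a" and \<phi> :: "nat \<Rightarrow> 'a \<Rightarrow> real"
  where "\<And>n. x n \<in> topspace X" "\<And>n. continuous_map X euclideanreal (\<phi> n)" "\<And>n. \<phi> n (x n) = 1"
    "\<And>n z. z \<in> topspace X \<Longrightarrow> 0 \<le> \<phi> n z \<and> \<phi> n z \<le> 1"
    "\<And>z. z \<in> topspace X \<Longrightarrow> \<exists>n. \<forall>m. m \<noteq> n \<longrightarrow> \<phi> m z = 0"
proof -
  obtain U :: "nat \<Rightarrow> 'a set" where U: "\<And>n. openin X (U n)" "\<And>n. U n \<noteq> {}"
    "\<And>m n. m \<noteq> n \<Longrightarrow> U m \<inter> U n = {}"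
    using infinite_Hausdorff_disjoint_open [OF assms(2,3)] by blast
  then have "\<forall>n. \<exists>z. z \<in> U n" by blast
  then obtain x where x: "\<And>n. x n \<in> U n" by metis
  have "\<forall>n. \<exists>\<phi>. continuous_map X euclideanreal \<phi> \<and> \<phi> (x n) = 1 \<and>
      (\<forall>z\<in>topspace X. 0 \<le> \<phi> z \<and> \<phi> z \<le> 1 \<and> (z \<notin> U n \<longrightarrow> \<phi> z = 0))"
    by (blast intro: completely_regular_bump [OF assms(1) U(1) x])
  from choice [OF this] obtain \<phi> where \<phi>: "\<And>n. continuous_map X euclideanreal (\<phi> n)"
      "\<And>n. \<phi> n (x n) = 1"
      "\<And>n z. z \<in> topspace X \<Longrightarrow> 0 \<le> \<phi> n z \<and> \<phi> n z \<le> 1"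
      "\<And>n z. \<lbrakk>z \<in> topspace X; z \<notin> U n\<rbrakk> \<Longrightarrow> \<phi> n z = 0"
    by blast
  have "\<exists>n. \<forall>m. m \<noteq> n \<longrightarrow> \<phi> m z = 0" if "z \<in> topspace X" for z
  proof (cases "\<exists>n. z \<in> U n")
    case True
    then obtain n where "z \<in> U n" by blast
    with U(3) have "z \<notin> U m" if "m \<noteq> n" for m using that by blast
    with \<phi>(4) that show ?thesis by blast
  qed (use \<phi>(4) that in blast)
  moreover have "x n \<in> topspace X" for n using x U(1) openin_subset by blast
  ultimately show thesis using that \<phi> by blast
qed

section \<open>Products without discrete sequences of open sets\<close>

text \<open>For an unbounded \<open>f\<close> there are points at which \<open>\<bar>f\<bar>\<close>
  grows by more than 1 at each step; the preimages of small intervals around these values form a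
  discrete sequence.\<close>

lemma no_discrete_sequence_imp_bounded:
  fixes f :: "'c \<Rightarrow> real"
  assumes none: "\<And>G. \<not> discrete_sequence Z G" and f: "continuous_map Z euclideanreal f"
  obtains C where "\<And>z. z \<in> topspace Z \<Longrightarrow> \<bar>f z\<bar> \<le> C"
proof -
  have "\<exists>C. \<forall>z\<in>topspace Z. \<bar>f z\<bar> \<le> C"
  proof (rule ccontr)
    assume "\<nexists>C. \<forall>z\<in>topspace Z. \<bar>f z\<bar> \<le> C"
    then have unb: "\<exists>z\<in>topspace Z. \<bar>f z\<bar> > C" for C
      by (metis not_le)
    have "\<exists>z. \<forall>n::nat. z n \<in> topspace Z \<and> \<bar>f (z (Suc n))\<bar> > \<bar>f (z n)\<bar> + 1"
      using unb by (intro dependent_nat_choice) auto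
    then obtain z where "\<forall>n::nat. z n \<in> topspace Z \<and> \<bar>f (z (Suc n))\<bar> > \<bar>f (z n)\<bar> + 1"
      by (elim exE)
    then have z: "z n \<in> topspace Z" "\<bar>f (z (Suc n))\<bar> > \<bar>f (z n)\<bar> + 1" for n
      by simp_all
    have gap: "\<bar>f (z n)\<bar> > \<bar>f (z m)\<bar> + 1" if "m < n" for m n
    proof -
      have "\<bar>f (z k)\<bar> \<le> \<bar>f (z (Suc k))\<bar>" for k
        using z(2) [of k] by linarith
      then have "\<bar>f (z (Suc m))\<bar> \<le> \<bar>f (z n)\<bar>"
        by (rule lift_Suc_mono_le [of "\<lambda>n. \<bar>f (z n)\<bar>"]) (use that in simp)
      with z(2) [of m] show ?thesis by linarith
    qed
    \<comment> \<open>With radius 1/4, \<open>\<bar>f\<bar>\<close> varies by less than 1/2 on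
      \<open>near a\<close>, whereas its values on \<open>near (z m)\<close> and
      \<open>near (z n)\<close> are more than 1/2 apart.\<close>
    define near where "near a = {w \<in> topspace Z. \<bar>f w\<bar> \<in> {\<bar>f a\<bar> - 1/4 <..< \<bar>f a\<bar> + 1/4}}" for a
    have op: "openin Z (near a)" for a
      unfolding near_def
      by (rule openin_continuous_map_preimage [where Y = euclideanreal])
        (auto intro!: continuous_intros f)
    have self: "a \<in> near a" if "a \<in> topspace Z" for a
      using that by (simp add: near_def)
    have "discrete_sequence Z (\<lambda>n. near (z n))"
      unfolding discrete_sequence_def
    proof (intro conjI allI ballI)
      show "openin Z (near (z n))" "near (z n) \<noteq> {}" for n
        using op self z(1) by blast+
      fix a assume "a \<in> topspace Z"
      moreover have "near a \<inter> near (z m) = {} \<or> near a \<inter> near (z n) = {}" if "m < n" for m n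
      proof (rule ccontr)
        assume "\<not> ?thesis"
        then obtain p q where "p \<in> near a" "p \<in> near (z m)" "q \<in> near a" "q \<in> near (z n)"
          by blast
        with gap [OF that] show False by (simp add: near_def)
      qed
      ultimately show "\<exists>U. openin Z U \<and> a \<in> U \<and>
          (\<forall>m n. m < n \<longrightarrow> U \<inter> near (z m) = {} \<or> U \<inter> near (z n) = {})"
        by (intro exI [of _ "near a"] conjI op self allI impI)
    qed
    with none show False by blast
  qed
  with that show thesis by blast
qed

lemma openin_prod_rectangle:
  assumes "openin (prod_topology X Y) S" "(x, y) \<in> S"
  obtains U V where "openin X U" "openin Y V" "x \<in> U" "y \<in> V" "U \<times> V \<subseteq> S"
  using assms unfolding openin_prod_topology_alt by meson

text \<open>
  If equicontinuity at \<open>x0\<close> fails, rectangles \<open>U n \<times> V n\<close> on which the oscillation is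
  large can be chosen with later \<open>U m\<close> so close to \<open>x0\<close> that the oscillation is
  small on \<open>U m \<times> V n\<close>. A small neighbourhood then meets at most one of them.
\<close>

lemma no_discrete_sequence_imp_equicontinuous:
  fixes f :: "'a \<times> 'b \<Rightarrow> real"
  assumes none: "\<And>G. \<not> discrete_sequence (prod_topology X Y) G"
    and f: "continuous_map (prod_topology X Y) euclideanreal f"
    and x0: "x0 \<in> topspace X" and "\<epsilon> > 0"
  shows "\<exists>U. openin X U \<and> x0 \<in> U \<and> (\<forall>x\<in>U. \<forall>y\<in>topspace Y. \<bar>f (x, y) - f (x0, y)\<bar> \<le> \<epsilon>)"
proof (rule ccontr)
  let ?Z = "prod_topology X Y"
  assume "\<not> ?thesis"
  then have bad: "\<exists>x\<in>W. \<exists>y\<in>topspace Y. \<bar>f (x, y) - f (x0, y)\<bar> > \<epsilon>" if "openin X W" "x0 \<in> W" for W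
    using that by (meson not_le)
  define g where "g p = \<bar>f p - f (x0, snd p)\<bar>" for p
  have "continuous_map ?Z ?Z (\<lambda>p. (x0, snd p))"
    using x0 by (intro continuous_map_pairedI continuous_map_snd) auto
  from continuous_map_compose [OF this f]
  have g: "continuous_map ?Z euclideanreal g"
    unfolding g_def by (intro continuous_intros f) (simp add: o_def)
  have gt: "openin ?Z {p \<in> topspace ?Z. g p \<in> {c<..}}" for c
    by (rule openin_continuous_map_preimage [OF g]) auto
  have lt: "openin ?Z {p \<in> topspace ?Z. g p \<in> {..<c}}" for c
    by (rule openin_continuous_map_preimage [OF g]) auto
  let ?P = "\<lambda>(U, V, W). openin X U \<and> openin Y V \<and> U \<noteq> {} \<and> V \<noteq> {} \<and> openin X W \<and> x0 \<in> W \<and>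
    (\<forall>p\<in>U \<times> V. g p > \<epsilon>) \<and> (\<forall>p\<in>W \<times> V. g p < \<epsilon> / 2)"
  \<comment> \<open>A rectangle around a bad point \<open>(x, y)\<close> inside \<open>W\<close> and
    one around \<open>(x0, y)\<close>, where \<open>g\<close> is 0, are given a common second
    factor, and both first factors are cut down to \<open>W\<close>.\<close>
  have step: "\<exists>t. ?P t \<and> fst t \<subseteq> W \<and> snd (snd t) \<subseteq> W" if W: "openin X W" "x0 \<in> W" for W
  proof -
    obtain x y where xy: "x \<in> W" "y \<in> topspace Y" "g (x, y) > \<epsilon>"
      using bad [OF W] by (auto simp: g_def)
    have "x \<in> topspace X" using xy W openin_subset by blast
    with xy have "(x, y) \<in> {p \<in> topspace ?Z. g p \<in> {\<epsilon><..}}" by simp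
    from openin_prod_rectangle [OF gt this] obtain U V where UV: "openin X U" "openin Y V" "x \<in> U" "y \<in> V"
        "U \<times> V \<subseteq> {p \<in> topspace ?Z. g p \<in> {\<epsilon><..}}" .
    have "(x0, y) \<in> {p \<in> topspace ?Z. g p \<in> {..<\<epsilon> / 2}}"
      using x0 xy \<open>\<epsilon> > 0\<close> by (simp add: g_def)
    from openin_prod_rectangle [OF lt this] obtain W' V' where WV: "openin X W'" "openin Y V'" "x0 \<in> W'" "y \<in> V'"
        "W' \<times> V' \<subseteq> {p \<in> topspace ?Z. g p \<in> {..<\<epsilon> / 2}}" .
    have "?P (U \<inter> W, V \<inter> V', W' \<inter> W)"
      using UV WV W xy by auto
    then show ?thesis by (intro exI [of _ "(U \<inter> W, V \<inter> V', W' \<inter> W)"]) auto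
  qed
  have "\<exists>s. \<forall>n. ?P (s n) \<and> fst (s (Suc n)) \<subseteq> snd (snd (s n)) \<and>
      snd (snd (s (Suc n))) \<subseteq> snd (snd (s n))"
  proof (rule dependent_nat_choice)
    show "\<exists>s. ?P s" using step [OF openin_topspace x0] by blast
    show "\<exists>t. ?P t \<and> fst t \<subseteq> snd (snd s) \<and> snd (snd t) \<subseteq> snd (snd s)" if "?P s" for s n
      using that by (intro step) (auto simp: case_prod_beta)
  qed
  then obtain s where "\<forall>n. ?P (s n) \<and> fst (s (Suc n)) \<subseteq> snd (snd (s n)) \<and>
      snd (snd (s (Suc n))) \<subseteq> snd (snd (s n))"
    by (elim exE)
  then have s: "?P (s n)" "fst (s (Suc n)) \<subseteq> snd (snd (s n))"
      "snd (snd (s (Suc n))) \<subseteq> snd (snd (s n))" for n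
    by (simp_all only:)
  define U where "U n = fst (s n)" for n
  define V where "V n = fst (snd (s n))" for n
  define W where "W n = snd (snd (s n))" for n
  have UVW: "openin X (U n)" "openin Y (V n)" "U n \<noteq> {}" "V n \<noteq> {}"
      "\<And>p. p \<in> U n \<times> V n \<Longrightarrow> g p > \<epsilon>" "\<And>p. p \<in> W n \<times> V n \<Longrightarrow> g p < \<epsilon> / 2" for n
    using s(1) [of n] by (auto simp: U_def V_def W_def case_prod_beta)
  have UW: "U n \<subseteq> W m" if "m < n" for m n
  proof -
    obtain k where k: "n = Suc k" "m \<le> k" using \<open>m < n\<close> by (metis Suc_le_D Suc_le_eq not_less_eq_eq)
    have "W k \<subseteq> W m" using s(3) k(2) unfolding W_def by (rule lift_Suc_antimono_le)
    with s(2) [of k] k show ?thesis by (auto simp: U_def W_def)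
  qed
  have "discrete_sequence ?Z (\<lambda>n. U n \<times> V n)"
    unfolding discrete_sequence_def
  proof (intro conjI allI ballI)
    show "openin ?Z (U n \<times> V n)" "U n \<times> V n \<noteq> {}" for n
      using UVW(1-4) [of n] by (auto simp: openin_prod_Times_iff)
    fix z assume z: "z \<in> topspace ?Z"
    obtain a b where ab: "z = (a, b)" by (cases z)
    show "\<exists>O'. openin ?Z O' \<and> z \<in> O' \<and>
        (\<forall>m n. m < n \<longrightarrow> O' \<inter> (U m \<times> V m) = {} \<or> O' \<inter> (U n \<times> V n) = {})"
    proof (cases "g z < \<epsilon>")
      case True
      have "{p \<in> topspace ?Z. g p \<in> {..<\<epsilon>}} \<inter> (U n \<times> V n) = {}" for n
        using UVW(5) [of _ n] by (fastforce dest: less_asym)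
      with z True lt [of \<epsilon>] show ?thesis
        by (intro exI [of _ "{p \<in> topspace ?Z. g p \<in> {..<\<epsilon>}}"]) simp
    next
      case False
      with z ab \<open>\<epsilon> > 0\<close> have "(a, b) \<in> {p \<in> topspace ?Z. g p \<in> {\<epsilon> / 2<..}}" by simp
      from openin_prod_rectangle [OF gt this] obtain A B where AB: "openin X A" "openin Y B" "a \<in> A" "b \<in> B"
          "A \<times> B \<subseteq> {p \<in> topspace ?Z. g p \<in> {\<epsilon> / 2<..}}" .
      \<comment> \<open>Points of \<open>A\<close> in \<open>U n\<close> and of \<open>B\<close> in
        \<open>V m\<close> combine to a point of \<open>A \<times> B\<close>, where \<open>g\<close>
        exceeds \<open>\<epsilon> / 2\<close>. As \<open>U n \<subseteq> W m\<close>, that point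
        also lies in \<open>W m \<times> V m\<close>, where \<open>g\<close> is below
        \<open>\<epsilon> / 2\<close>.\<close>
      have "(A \<times> B) \<inter> (U m \<times> V m) = {} \<or> (A \<times> B) \<inter> (U n \<times> V n) = {}" if "m < n" for m n
      proof (rule ccontr)
        assume "\<not> ?thesis"
        then obtain p q where pq: "p \<in> A" "p \<in> U n" "q \<in> B" "q \<in> V m" by blast
        with UW [OF that] have "g (p, q) < \<epsilon> / 2" by (intro UVW(6)) blast
        moreover have "g (p, q) > \<epsilon> / 2" using AB(5) pq by blast
        ultimately show False by simp
      qed
      with AB ab show ?thesis
        by (intro exI [of _ "A \<times> B"]) (auto simp: openin_prod_Times_iff)
    qed
  qed
  with none show False by blast
qed

text \<open>Without a finite net there is an infinite sequence \<open>x n\<close> whose sections are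
  more than \<open>\<epsilon>\<close> apart. Around each point \<open>a\<close> equicontinuity gives
  \<open>U a\<close> with deviation at most \<open>\<epsilon> / 4\<close>. If \<open>U a\<close> met
  both \<open>U (x m)\<close> and \<open>U (x n)\<close>, four such deviations would join the
  sections at \<open>x m\<close> and \<open>x n\<close>. Hence the strips over the sets
  \<open>U (x n)\<close> form a discrete sequence.\<close>

lemma no_discrete_sequence_imp_totally_bounded:
  fixes f :: "'a \<times> 'b \<Rightarrow> real"
  assumes none: "\<And>G. \<not> discrete_sequence (prod_topology X Y) G"
    and f: "continuous_map (prod_topology X Y) euclideanreal f"
    and Y: "topspace Y \<noteq> {}" and "\<epsilon> > 0"
  shows "\<exists>K. finite K \<and> K \<subseteq> topspace X \<and>
    (\<forall>x\<in>topspace X. \<exists>x'\<in>K. \<forall>y\<in>topspace Y. \<bar>f (x, y) - f (x', y)\<bar> \<le> \<epsilon>)"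
proof (rule ccontr)
  let ?Z = "prod_topology X Y"
  let ?far = "\<lambda>x x'. \<exists>y\<in>topspace Y. \<bar>f (x, y) - f (x', y)\<bar> > \<epsilon>"
  assume "\<not> ?thesis"
  then have new: "\<exists>x\<in>topspace X. \<forall>x'\<in>K. ?far x x'" if "finite K" "K \<subseteq> topspace X" for K
    using that by (meson not_le)
  have "\<exists>x. \<forall>n::nat. x n \<in> topspace X \<and> (\<forall>m<n. ?far (x n) (x m))"
  proof (rule dependent_wellorder_choice)
    fix x and n :: nat
    assume "\<And>m. m < n \<Longrightarrow> x m \<in> topspace X \<and> (\<forall>k<m. ?far (x m) (x k))"
    then have "x ` {..<n} \<subseteq> topspace X" by auto
    then obtain r where "r \<in> topspace X" "\<forall>x'\<in>x ` {..<n}. ?far r x'"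
      using new [of "x ` {..<n}"] by auto
    then show "\<exists>r. r \<in> topspace X \<and> (\<forall>m<n. ?far r (x m))"
      by (intro exI [of _ r]) simp
  qed auto
  then obtain x where "\<forall>n::nat. x n \<in> topspace X \<and> (\<forall>m<n. ?far (x n) (x m))"
    by (elim exE)
  then have x: "x n \<in> topspace X" "m < n \<Longrightarrow> ?far (x n) (x m)" for m n
    by simp_all
  have "\<forall>a\<in>topspace X. \<exists>U. openin X U \<and> a \<in> U \<and>
      (\<forall>x\<in>U. \<forall>y\<in>topspace Y. \<bar>f (x, y) - f (a, y)\<bar> \<le> \<epsilon> / 4)"
    by (intro ballI no_discrete_sequence_imp_equicontinuous [OF none f]) (use \<open>\<epsilon> > 0\<close> in simp_all)
  from bchoice [OF this] obtain U where "\<forall>a\<in>topspace X. openin X (U a) \<and> a \<in> U a \<and>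
      (\<forall>x\<in>U a. \<forall>y\<in>topspace Y. \<bar>f (x, y) - f (a, y)\<bar> \<le> \<epsilon> / 4)"
    by (elim exE)
  then have U: "a \<in> topspace X \<Longrightarrow> openin X (U a) \<and> a \<in> U a"
      "\<lbrakk>a \<in> topspace X; x \<in> U a; y \<in> topspace Y\<rbrakk> \<Longrightarrow> \<bar>f (x, y) - f (a, y)\<bar> \<le> \<epsilon> / 4" for a x y
    by simp_all
  have disj: "U a \<inter> U (x m) = {} \<or> U a \<inter> U (x n) = {}" if mn: "m < n" and a: "a \<in> topspace X" for a m n
  proof (rule ccontr)
    assume "\<not> ?thesis"
    then obtain p q where pq: "p \<in> U a" "p \<in> U (x m)" "q \<in> U a" "q \<in> U (x n)" by blast
    obtain y where y: "y \<in> topspace Y" "\<bar>f (x n, y) - f (x m, y)\<bar> > \<epsilon>" using x(2) [OF mn] by blast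
    show False
      using U(2) [OF a pq(1) y(1)] U(2) [OF a pq(3) y(1)]
        U(2) [OF x(1) pq(2) y(1)] U(2) [OF x(1) pq(4) y(1)] y(2) by linarith
  qed
  have "discrete_sequence ?Z (\<lambda>n. U (x n) \<times> topspace Y)"
    unfolding discrete_sequence_def
  proof (intro conjI allI ballI)
    show "openin ?Z (U (x n) \<times> topspace Y)" "U (x n) \<times> topspace Y \<noteq> {}" for n
      using U(1) [OF x(1) [of n]] Y by (auto simp: openin_prod_Times_iff)
    fix z assume "z \<in> topspace ?Z"
    then obtain a b where z: "z = (a, b)" "a \<in> topspace X" "b \<in> topspace Y" by auto
    show "\<exists>O'. openin ?Z O' \<and> z \<in> O' \<and> (\<forall>m n. m < n \<longrightarrow>
        O' \<inter> (U (x m) \<times> topspace Y) = {} \<or> O' \<inter> (U (x n) \<times> topspace Y) = {})"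
      using U(1) [OF z(2)] z disj
      by (intro exI [of _ "U a \<times> topspace Y"]) (auto simp: openin_prod_Times_iff Times_Int_Times)
  qed
  with none show False by blast
qed

section \<open>Rademacher averages\<close>

text \<open>Subsets of \<open>{..<n}\<close> stand for the vertices of the cube of sign vectors of
  length \<open>n\<close>; this is the coordinate \<open>i\<close> of the vertex
  \<open>s\<close>.\<close>

definition rademacher :: "nat \<Rightarrow> nat set \<Rightarrow> real" where
  "rademacher i s = (if i \<in> s then 1 else - 1)"

lemma rademacher_square [simp]: "rademacher i s * rademacher i s = 1"
  by (simp add: rademacher_def)

lemma abs_rademacher [simp]: "\<bar>rademacher i s\<bar> = 1"
  by (simp add: rademacher_def)

text \<open>Orthogonality of the signs: the mixed products cancel over the cube. In the induction
  the subsets are split according to whether they contain \<open>n\<close>, and the two halves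
  combine by the parallelogram identity.\<close>

lemma sum_rademacher_square:
  "(\<Sum>s\<in>Pow {..<n}. (\<Sum>i<n. g i * rademacher i s)\<^sup>2) = 2 ^ n * (\<Sum>i<n. (g i)\<^sup>2)"
proof (induction n)
  case (Suc n)
  let ?S = "\<lambda>s. \<Sum>i<n. g i * rademacher i s"
  have ins: "?S (insert n s) = ?S s" for s
    by (intro sum.cong) (auto simp: rademacher_def)
  have inj: "inj_on (insert n) (Pow {..<n})"
    by (auto simp: inj_on_def)
  have "(\<Sum>s\<in>Pow {..<Suc n}. (\<Sum>i<Suc n. g i * rademacher i s)\<^sup>2) =
      (\<Sum>s\<in>Pow {..<n}. (?S s + g n * rademacher n s)\<^sup>2) +
      (\<Sum>s\<in>insert n ` Pow {..<n}. (?S s + g n * rademacher n s)\<^sup>2)"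
    unfolding lessThan_Suc Pow_insert
    by (subst sum.union_disjoint) (auto simp: add.commute)
  also have "(\<Sum>s\<in>Pow {..<n}. (?S s + g n * rademacher n s)\<^sup>2) = (\<Sum>s\<in>Pow {..<n}. (?S s - g n)\<^sup>2)"
    by (intro sum.cong) (auto simp: rademacher_def)
  also have "(\<Sum>s\<in>insert n ` Pow {..<n}. (?S s + g n * rademacher n s)\<^sup>2) =
      (\<Sum>s\<in>Pow {..<n}. (?S s + g n)\<^sup>2)"
    using inj by (simp add: sum.reindex ins) (simp add: rademacher_def)
  also have "(\<Sum>s\<in>Pow {..<n}. (?S s - g n)\<^sup>2) + (\<Sum>s\<in>Pow {..<n}. (?S s + g n)\<^sup>2) =
      (\<Sum>s\<in>Pow {..<n}. 2 * (?S s)\<^sup>2 + 2 * (g n)\<^sup>2)"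
    unfolding sum.distrib [symmetric] by (intro sum.cong) (auto simp: power2_eq_square algebra_simps)
  also have "\<dots> = 2 * (\<Sum>s\<in>Pow {..<n}. (?S s)\<^sup>2) + 2 ^ n * (2 * (g n)\<^sup>2)"
    by (simp add: sum.distrib sum_distrib_left card_Pow)
  finally show ?case
    by (simp add: Suc.IH algebra_simps)
qed simp

text \<open>The Cauchy-Schwarz inequality passes from the mean square, which is at most
  \<open>n\<close>, to the mean absolute value.\<close>

lemma sum_abs_rademacher_le:
  assumes "\<And>i. i < n \<Longrightarrow> \<bar>g i\<bar> \<le> 1"
  shows "(\<Sum>s\<in>Pow {..<n}. \<bar>\<Sum>i<n. g i * rademacher i s\<bar>) \<le> 2 ^ n * sqrt n"
proof -
  let ?S = "\<lambda>s. \<Sum>i<n. g i * rademacher i s"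
  have "(\<Sum>i<n. (g i)\<^sup>2) \<le> (\<Sum>i<n. 1)"
    using assms by (intro sum_mono) (simp add: abs_square_le_1)
  then have sq: "(\<Sum>i<n. (g i)\<^sup>2) \<le> n" by simp
  have "(\<Sum>s\<in>Pow {..<n}. \<bar>?S s\<bar>)\<^sup>2 \<le> (\<Sum>s\<in>Pow {..<n}. \<bar>?S s\<bar>\<^sup>2) * card (Pow {..<n})"
    by (rule sum_squared_le_sum_of_squares)
  also have "\<dots> = (2 ^ n)\<^sup>2 * (\<Sum>i<n. (g i)\<^sup>2)"
    by (simp only: power2_abs sum_rademacher_square) (simp add: card_Pow power2_eq_square [of "2 ^ n"])
  also have "\<dots> \<le> (2 ^ n)\<^sup>2 * real n"
    by (intro mult_left_mono sq) simp
  also have "\<dots> = (2 ^ n * sqrt n)\<^sup>2"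
    by (simp add: power_mult_distrib)
  finally show ?thesis
    by (rule power2_le_imp_le) simp
qed

text \<open>
  Up to an error \<open>\<delta>\<close> the function \<open>f\<close> agrees with the sum over the finite net
  \<open>K\<close> of products of an indicator function in \<open>x\<close> and a bounded function in \<open>y\<close>.
  On each such product the Rademacher average is at most \<open>C / sqrt n\<close>.
\<close>

lemma rademacher_average_le:
  fixes f :: "'a \<times> 'b \<Rightarrow> real"
  assumes C: "\<And>x y. \<lbrakk>x \<in> A; y \<in> B\<rbrakk> \<Longrightarrow> \<bar>f (x, y)\<bar> \<le> C"
    and K: "finite K" "K \<subseteq> A"
    and net: "\<And>x. x \<in> A \<Longrightarrow> \<exists>x'\<in>K. \<forall>y\<in>B. \<bar>f (x, y) - f (x', y)\<bar> \<le> \<delta>"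
    and a: "\<And>i. i < n \<Longrightarrow> a i \<in> A" and b: "\<And>s. s \<subseteq> {..<n} \<Longrightarrow> b s \<in> B"
    and "n > 0" and "B \<noteq> {}"
  shows "\<bar>\<Sum>s\<in>Pow {..<n}. \<Sum>i<n. rademacher i s * f (a i, b s)\<bar> / (real n * 2 ^ n)
    \<le> \<delta> + real (card K) * C / sqrt n"
proof -
  have "\<forall>x\<in>A. \<exists>x'. x' \<in> K \<and> (\<forall>y\<in>B. \<bar>f (x, y) - f (x', y)\<bar> \<le> \<delta>)"
    using net by blast
  from bchoice [OF this] obtain r where
    "\<forall>x\<in>A. r x \<in> K \<and> (\<forall>y\<in>B. \<bar>f (x, y) - f (r x, y)\<bar> \<le> \<delta>)"
    by (elim exE)
  then have r: "x \<in> A \<Longrightarrow> r x \<in> K" "\<lbrakk>x \<in> A; y \<in> B\<rbrakk> \<Longrightarrow> \<bar>f (x, y) - f (r x, y)\<bar> \<le> \<delta>" for x y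
    by simp_all
  have C0: "C \<ge> 0" if "p \<in> K" for p
  proof -
    obtain y where "y \<in> B" using \<open>B \<noteq> {}\<close> by blast
    then show ?thesis using C [of p y] that K(2) by force
  qed
  \<comment> \<open>The indices \<open>i\<close> are grouped by the net point assigned to
    \<open>a i\<close>; \<open>g p\<close> is the indicator of the group of
    \<open>p\<close>.\<close>
  define g where "g p i = (if r (a i) = p then 1 else 0 :: real)" for p i
  have split: "(\<Sum>i<n. rademacher i s * f (a i, b s)) =
      (\<Sum>i<n. rademacher i s * (f (a i, b s) - f (r (a i), b s))) +
      (\<Sum>p\<in>K. f (p, b s) * (\<Sum>i<n. g p i * rademacher i s))" for s
  proof -
    have "(\<Sum>p\<in>K. f (p, b s) * (\<Sum>i<n. g p i * rademacher i s)) =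
        (\<Sum>i<n. \<Sum>p\<in>K. f (p, b s) * (g p i * rademacher i s))"
      unfolding sum_distrib_left by (rule sum.swap)
    also have "\<dots> = (\<Sum>i<n. rademacher i s * f (r (a i), b s))"
    proof (rule sum.cong)
      fix i assume "i \<in> {..<n}"
      then have "r (a i) \<in> K" using r(1) a by simp
      have "(\<Sum>p\<in>K. f (p, b s) * (g p i * rademacher i s)) =
          (\<Sum>p\<in>K. if r (a i) = p then f (p, b s) * rademacher i s else 0)"
        by (intro sum.cong) (auto simp: g_def)
      with \<open>r (a i) \<in> K\<close> K(1)
      show "(\<Sum>p\<in>K. f (p, b s) * (g p i * rademacher i s)) = rademacher i s * f (r (a i), b s)"
        by (simp add: sum.delta')
    qed simp
    finally show ?thesis
      by (simp add: sum_subtractf right_diff_distrib)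
  qed
  have bound: "\<bar>\<Sum>i<n. rademacher i s * f (a i, b s)\<bar> \<le>
      n * \<delta> + (\<Sum>p\<in>K. C * \<bar>\<Sum>i<n. g p i * rademacher i s\<bar>)" if s: "s \<in> Pow {..<n}" for s
  proof -
    have "\<bar>\<Sum>i<n. rademacher i s * (f (a i, b s) - f (r (a i), b s))\<bar> \<le> (\<Sum>i<n. \<delta>)"
      using s r(2) a b by (intro order.trans [OF sum_abs] sum_mono) (simp add: abs_mult)
    moreover have "\<bar>\<Sum>p\<in>K. f (p, b s) * (\<Sum>i<n. g p i * rademacher i s)\<bar> \<le>
        (\<Sum>p\<in>K. C * \<bar>\<Sum>i<n. g p i * rademacher i s\<bar>)"
      using s K(2) b
      by (intro order.trans [OF sum_abs] sum_mono) (auto simp: abs_mult intro!: mult_right_mono C)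
    ultimately show ?thesis
      unfolding split by simp
  qed
  have "\<bar>\<Sum>s\<in>Pow {..<n}. \<Sum>i<n. rademacher i s * f (a i, b s)\<bar> \<le>
      (\<Sum>s\<in>Pow {..<n}. n * \<delta> + (\<Sum>p\<in>K. C * \<bar>\<Sum>i<n. g p i * rademacher i s\<bar>))"
    by (intro order.trans [OF sum_abs] sum_mono bound)
  also have "\<dots> = 2 ^ n * (n * \<delta>) +
      (\<Sum>p\<in>K. C * (\<Sum>s\<in>Pow {..<n}. \<bar>\<Sum>i<n. g p i * rademacher i s\<bar>))"
    unfolding sum.distrib sum_distrib_left by (subst (2) sum.swap) (simp add: card_Pow)
  also have "\<dots> \<le> 2 ^ n * (n * \<delta>) + (\<Sum>p\<in>K. C * (2 ^ n * sqrt n))"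
    by (intro add_left_mono sum_mono mult_left_mono sum_abs_rademacher_le C0) (auto simp: g_def)
  also have "\<dots> = (\<delta> + real (card K) * C / sqrt n) * (real n * 2 ^ n)"
  proof -
    have "(\<delta> + real (card K) * C / sqrt n) * (real n * 2 ^ n) =
        2 ^ n * (n * \<delta>) + real (card K) * (C * (2 ^ n * (n / sqrt n)))"
      by (simp add: algebra_simps)
    then show ?thesis by (simp only: sum_constant) (simp add: real_div_sqrt)
  qed
  finally show ?thesis
    using \<open>n > 0\<close> by (simp add: divide_le_eq)
qed

text \<open>A net for \<open>\<epsilon> / 2\<close> fixes \<open>card K * C\<close>, so the second
  term of the bound decays like the inverse square root. The bound does not depend on the points
  chosen, hence they may change with \<open>n\<close>.\<close>

lemma rademacher_average_tendsto_0:
  fixes f :: "'a \<times> 'b \<Rightarrow> real"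
  assumes C: "\<And>x y. \<lbrakk>x \<in> A; y \<in> B\<rbrakk> \<Longrightarrow> \<bar>f (x, y)\<bar> \<le> C"
    and net: "\<And>\<delta>. \<delta> > 0 \<Longrightarrow> \<exists>K. finite K \<and> K \<subseteq> A \<and>
      (\<forall>x\<in>A. \<exists>x'\<in>K. \<forall>y\<in>B. \<bar>f (x, y) - f (x', y)\<bar> \<le> \<delta>)"
    and a: "\<And>n i. a n i \<in> A" and b: "\<And>s. b s \<in> B"
  shows "(\<lambda>n. (\<Sum>s\<in>Pow {..<Suc n}. \<Sum>i<Suc n. rademacher i s * f (a n i, b s)) / (real (Suc n) * 2 ^ Suc n))
    \<longlonglongrightarrow> 0"
proof (rule LIMSEQ_I)
  fix \<epsilon> :: real assume "\<epsilon> > 0"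
  let ?m = "\<lambda>n. (\<Sum>s\<in>Pow {..<Suc n}. \<Sum>i<Suc n. rademacher i s * f (a n i, b s)) / (real (Suc n) * 2 ^ Suc n)"
  obtain K where K: "finite K" "K \<subseteq> A" "\<forall>x\<in>A. \<exists>x'\<in>K. \<forall>y\<in>B. \<bar>f (x, y) - f (x', y)\<bar> \<le> \<epsilon> / 2"
    using net [of "\<epsilon> / 2"] \<open>\<epsilon> > 0\<close> by auto
  have "B \<noteq> {}" using b by blast
  have le: "\<bar>?m n\<bar> \<le> \<epsilon> / 2 + real (card K) * C / sqrt (Suc n)" for n
  proof -
    have "\<bar>?m n\<bar> = \<bar>\<Sum>s\<in>Pow {..<Suc n}. \<Sum>i<Suc n. rademacher i s * f (a n i, b s)\<bar> / (real (Suc n) * 2 ^ Suc n)"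
      by (simp only: abs_divide) simp
    also have "\<dots> \<le> \<epsilon> / 2 + real (card K) * C / sqrt (Suc n)"
      by (rule rademacher_average_le [where f = f and A = A and B = B])
        (use C K a b \<open>B \<noteq> {}\<close> in simp_all)
    finally show ?thesis .
  qed
  have "(\<lambda>n. real (card K) * C / sqrt (Suc n)) \<longlonglongrightarrow> 0"
    by (intro tendsto_divide_0 [OF tendsto_const] filterlim_at_top_imp_at_infinity
        filterlim_compose [OF sqrt_at_top] filterlim_compose [OF filterlim_real_sequentially]
        filterlim_Suc)
  then obtain N where N: "\<And>n. n \<ge> N \<Longrightarrow> real (card K) * C / sqrt (Suc n) < \<epsilon> / 2"
    using LIMSEQ_D [of _ 0 "\<epsilon> / 2"] \<open>\<epsilon> > 0\<close> by (metis abs_less_iff diff_zero half_gt_zero real_norm_def)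
  have "norm (?m n - 0) < \<epsilon>" if "n \<ge> N" for n
    using le [of n] N [OF that] unfolding real_norm_def diff_0_right by linarith
  then show "\<exists>N. \<forall>n\<ge>N. norm (?m n - 0) < \<epsilon>" by blast
qed

section \<open>The two cases\<close>

lemma no_discrete_sequence_imp_linearly_homeomorphic:
  fixes X :: "'a topology" and Y :: "'b topology"
  assumes X: "completely_regular_space X" "Hausdorff_space X" "infinite (topspace X)"
    and Y: "completely_regular_space Y" "Hausdorff_space Y" "infinite (topspace Y)"
    and none: "\<And>G. \<not> discrete_sequence (prod_topology X Y) G"
  shows "linearly_homeomorphic (Cp (prod_topology X Y)) (tvs_prod (Cp (prod_topology X Y)) tvs_real)"
proof -
  let ?Z = "prod_topology X Y"
  from disjoint_bumps [OF X]
  obtain x :: "nat \<Rightarrow> 'a" and \<phi> :: "nat \<Rightarrow> 'a \<Rightarrow> real" where x: "\<And>n. x n \<in> topspace X"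
    and \<phi>: "\<And>n. continuous_map X euclideanreal (\<phi> n)" "\<And>n. \<phi> n (x n) = 1"
    "\<And>n u. u \<in> topspace X \<Longrightarrow> 0 \<le> \<phi> n u \<and> \<phi> n u \<le> 1"
    "\<And>u. u \<in> topspace X \<Longrightarrow> \<exists>n. \<forall>m. m \<noteq> n \<longrightarrow> \<phi> m u = 0"
    by blast
  from disjoint_bumps [OF Y]
  obtain y :: "nat \<Rightarrow> 'b" and \<psi> :: "nat \<Rightarrow> 'b \<Rightarrow> real" where y: "\<And>n. y n \<in> topspace Y"
    and \<psi>: "\<And>n. continuous_map Y euclideanreal (\<psi> n)" "\<And>n. \<psi> n (y n) = 1"
    "\<And>n v. v \<in> topspace Y \<Longrightarrow> 0 \<le> \<psi> n v \<and> \<psi> n v \<le> 1"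
    "\<And>v. v \<in> topspace Y \<Longrightarrow> \<exists>n. \<forall>m. m \<noteq> n \<longrightarrow> \<psi> m v = 0"
    by blast
  \<comment> \<open>Pairing the indices gives each block \<open>n\<close> its own points of
    \<open>X\<close>, so that the functions \<open>e n\<close> get disjoint supports. The points
    \<open>b s\<close> of \<open>Y\<close> are shared by all blocks.\<close>
  define a where "a n i = x (prod_encode (n, i))" for n i
  define \<alpha> where "\<alpha> n i = \<phi> (prod_encode (n, i))" for n i
  \<comment> \<open>\<open>set_encode\<close> is injective only on finite sets; hence the finiteness
    conditions on \<open>s\<close> and \<open>t\<close> below.\<close>
  define b where "b s = y (set_encode s)" for s
  define \<beta> where "\<beta> s = \<psi> (set_encode s)" for s
  have aX: "a n i \<in> topspace X" and bY: "b s \<in> topspace Y" for n i s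
    using x y by (simp_all add: a_def b_def)
  have \<alpha>_supp: "\<exists>n i. \<forall>n' i'. (n', i') \<noteq> (n, i) \<longrightarrow> \<alpha> n' i' u = 0" if u: "u \<in> topspace X" for u
  proof -
    obtain k where k: "\<And>m. m \<noteq> k \<Longrightarrow> \<phi> m u = 0" using \<phi>(4) [OF u] by blast
    obtain n i where "prod_decode k = (n, i)" by (cases "prod_decode k")
    then have ni: "k = prod_encode (n, i)" by (metis prod_decode_inverse)
    have "\<alpha> n' i' u = 0" if "(n', i') \<noteq> (n, i)" for n' i'
      unfolding \<alpha>_def by (rule k) (use that in \<open>simp add: ni prod_encode_eq\<close>)
    then show ?thesis by blast
  qed
  have \<beta>_supp: "\<exists>s. \<forall>t. finite t \<longrightarrow> t \<noteq> s \<longrightarrow> \<beta> t v = 0" if v: "v \<in> topspace Y" for v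
  proof -
    obtain k where k: "\<And>m. m \<noteq> k \<Longrightarrow> \<psi> m v = 0" using \<psi>(4) [OF v] by blast
    have "\<beta> t v = 0" if "finite t" "t \<noteq> set_decode k" for t
      unfolding \<beta>_def by (rule k) (use that in \<open>metis set_encode_inverse\<close>)
    then show ?thesis by blast
  qed
  have \<alpha>_a: "\<alpha> n i (a n i) = 1" and \<beta>_b: "\<beta> s (b s) = 1" for n i s
    using \<phi>(2) \<psi>(2) by (simp_all add: \<alpha>_def a_def \<beta>_def b_def)
  have \<alpha>_off: "\<alpha> n' i' (a n i) = 0" if "(n', i') \<noteq> (n, i)" for n i n' i'
    using \<alpha>_supp [OF aX [of n i]] \<alpha>_a [of n i] that by (metis zero_neq_one)
  have \<beta>_off: "\<beta> t (b s) = 0" if "finite s" "finite t" "t \<noteq> s" for s t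
    using \<beta>_supp [OF bY [of s]] \<beta>_b [of s] that by (metis zero_neq_one)
  \<comment> \<open>A signed sum of product bumps on the grid of points \<open>(a n i, b s)\<close>,
    arranged so that its value at each grid point of block \<open>n\<close> is the sign
    there.\<close>
  define e where "e n z = (\<Sum>s\<in>Pow {..<Suc n}. \<Sum>i<Suc n.
      rademacher i s * (\<alpha> n i (fst z) * \<beta> s (snd z)))" for n z
  \<comment> \<open>At \<open>(u, v)\<close> at most one \<open>\<alpha>\<close> and, among finite
    sets, at most one \<open>\<beta>\<close> is nonzero, so at most one term of the double sum
    survives.\<close>
  have e_single: "e m (u, v) = (if m = n \<and> i < Suc n \<and> s \<subseteq> {..<Suc n}
      then rademacher i s * (\<alpha> n i u * \<beta> s v) else 0)"
    if \<alpha>0: "\<And>n' i'. (n', i') \<noteq> (n, i) \<Longrightarrow> \<alpha> n' i' u = 0"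
      and \<beta>0: "\<And>t. \<lbrakk>finite t; t \<noteq> s\<rbrakk> \<Longrightarrow> \<beta> t v = 0" for m n i s u v
  proof -
    define c where "c = (if m = n then rademacher i s * (\<alpha> n i u * \<beta> s v) else 0)"
    have "rademacher i' t * (\<alpha> m i' u * \<beta> t v) = (if t = s then if i' = i then c else 0 else 0)"
      if "t \<in> Pow {..<Suc m}" for t i'
      using \<alpha>0 [of m i'] \<beta>0 [of t] that finite_subset [of t "{..<Suc m}"]
      by (auto simp: c_def)
    then have "e m (u, v) = (\<Sum>t\<in>Pow {..<Suc m}. \<Sum>i'<Suc m. if t = s then if i' = i then c else 0 else 0)"
      unfolding e_def fst_conv snd_conv by (intro sum.cong refl) blast
    also have "\<dots> = (\<Sum>t\<in>Pow {..<Suc m}. if t = s then \<Sum>i'<Suc m. if i' = i then c else 0 else 0)"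
      by (intro sum.cong) auto
    also have "\<dots> = (if s \<in> Pow {..<Suc m} \<and> i < Suc m then c else 0)"
      by (simp only: sum.delta finite_Pow_iff finite_lessThan) auto
    finally show ?thesis by (auto simp: c_def)
  qed
  have e_point: "e m (a n i, b s) = (if m = n \<and> i < Suc n \<and> s \<subseteq> {..<Suc n} then rademacher i s else 0)"
    if "finite s" for m n i s
    by (subst e_single [where n = n and i = i and s = s])
      (use that in \<open>simp_all add: \<alpha>_off \<beta>_off \<alpha>_a \<beta>_b\<close>)
  have e_supp: "\<exists>n. (\<forall>m. m \<noteq> n \<longrightarrow> e m z = 0) \<and> \<bar>e n z\<bar> \<le> 1" if z: "z \<in> topspace ?Z" for z
  proof -
    obtain u v where uv: "z = (u, v)" "u \<in> topspace X" "v \<in> topspace Y" using z by auto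
    obtain n i where ni: "\<And>n' i'. (n', i') \<noteq> (n, i) \<Longrightarrow> \<alpha> n' i' u = 0" using \<alpha>_supp [OF uv(2)] by blast
    obtain s where s: "\<And>t. \<lbrakk>finite t; t \<noteq> s\<rbrakk> \<Longrightarrow> \<beta> t v = 0" using \<beta>_supp [OF uv(3)] by blast
    have "\<bar>\<alpha> n i u * \<beta> s v\<bar> \<le> 1"
      using \<phi>(3) [OF uv(2)] \<psi>(3) [OF uv(3)] unfolding \<alpha>_def \<beta>_def
      by (simp add: abs_mult mult_le_one)
    moreover have "e m (u, v) = (if m = n \<and> i < Suc n \<and> s \<subseteq> {..<Suc n}
        then rademacher i s * (\<alpha> n i u * \<beta> s v) else 0)" for m
      by (rule e_single) (use ni s in blast)+
    ultimately have "(\<forall>m. m \<noteq> n \<longrightarrow> e m z = 0) \<and> \<bar>e n z\<bar> \<le> 1"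
      unfolding uv(1) by (simp add: abs_mult)
    then show ?thesis by blast
  qed
  have e_cont: "continuous_map ?Z euclideanreal (e n)" for n
  proof -
    have "continuous_map ?Z euclideanreal (\<lambda>z. \<alpha> n i (fst z))" for i
      using continuous_map_compose [OF continuous_map_fst \<phi>(1)] by (simp add: o_def \<alpha>_def)
    moreover have "continuous_map ?Z euclideanreal (\<lambda>z. \<beta> s (snd z))" for s
      using continuous_map_compose [OF continuous_map_snd \<psi>(1)] by (simp add: o_def \<beta>_def)
    ultimately show ?thesis
      unfolding e_def [abs_def] by (intro continuous_intros) auto
  qed
  define F where "F n = (\<lambda>(s, i). (a n i, b s)) ` (Pow {..<Suc n} \<times> {..<Suc n})" for n
  \<comment> \<open>On \<open>F n\<close> the function \<open>e n\<close> is the sign itself, so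
    dividing it by the number of grid points gives the weights of the signed average; applied to
    \<open>e n\<close>, this averages squares of signs.\<close>
  define w where "w n z = e n z / (real (Suc n) * 2 ^ Suc n)" for n z
  have F_sum: "(\<Sum>z\<in>F n. w n z * f z) =
      (\<Sum>s\<in>Pow {..<Suc n}. \<Sum>i<Suc n. rademacher i s * f (a n i, b s)) / (real (Suc n) * 2 ^ Suc n)"
    for n and f :: "'a \<times> 'b \<Rightarrow> real"
  proof -
    \<comment> \<open>The bumps separate the grid points, so the sum over the image
      \<open>F n\<close> can be reindexed by pairs \<open>(s, i)\<close> without merging
      terms.\<close>
    have a_inj: "i = j" if "a n i = a n j" for i j
      using \<alpha>_off [of n i n j] \<alpha>_a [of n i] that by (metis prod.inject zero_neq_one)
    have b_inj: "s = t" if "b s = b t" "finite s" "finite t" for s t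
      using \<beta>_off [of t s] \<beta>_b [of s] that by (metis zero_neq_one)
    have "inj_on (\<lambda>(s, i). (a n i, b s)) (Pow {..<Suc n} \<times> {..<Suc n})"
    proof (rule inj_onI, clarify)
      fix s t i j
      assume "s \<subseteq> {..<Suc n}" "t \<subseteq> {..<Suc n}" "a n i = a n j" "b s = b t"
      then show "s = t \<and> i = j"
        using a_inj b_inj finite_subset [OF _ finite_lessThan] by blast
    qed
    then have "(\<Sum>z\<in>F n. w n z * f z) =
        (\<Sum>(s, i)\<in>Pow {..<Suc n} \<times> {..<Suc n}. w n (a n i, b s) * f (a n i, b s))"
      unfolding F_def by (subst sum.reindex) (simp_all add: case_prod_beta o_def)
    also have "\<dots> = (\<Sum>(s, i)\<in>Pow {..<Suc n} \<times> {..<Suc n}.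
        rademacher i s * f (a n i, b s) / (real (Suc n) * 2 ^ Suc n))"
    proof (rule sum.cong [OF refl])
      fix p assume "p \<in> Pow {..<Suc n} \<times> {..<Suc n}"
      then obtain s i where p: "p = (s, i)" "s \<subseteq> {..<Suc n}" "i < Suc n" by auto
      then have "e n (a n i, b s) = rademacher i s"
        using e_point [of s n n i] finite_subset [OF p(2)] by simp
      then show "(case p of (s, i) \<Rightarrow> w n (a n i, b s) * f (a n i, b s)) =
          (case p of (s, i) \<Rightarrow> rademacher i s * f (a n i, b s) / (real (Suc n) * 2 ^ Suc n))"
        by (simp add: p(1) w_def)
    qed
    finally show ?thesis
      unfolding sum.cartesian_product sum_divide_distrib by (simp only: case_prod_unfold)
  qed
  \<comment> \<open>Null sequences remain null under both shifts, they suffice for continuity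
    because the \<open>e n\<close> are bounded by 1, and they contain all coefficient sequences by
    the Rademacher estimate.\<close>
  interpret biorthogonal_system ?Z e F w "\<lambda>c. c \<longlonglongrightarrow> 0"
  proof
    show "F n \<subseteq> topspace ?Z" for n
      using aX bY by (auto simp: F_def)
    show "e m z = 0" if z: "z \<in> F n" and mn: "m \<noteq> n" for z n m
    proof -
      obtain s i where "z = (a n i, b s)" "s \<subseteq> {..<Suc n}"
        using z by (auto simp: F_def)
      with e_point [of s m n i] mn show ?thesis
        using finite_subset [of s "{..<Suc n}"] by simp
    qed
    show "(\<Sum>z\<in>F n. w n z * e n z) = 1" for n
    proof -
      have "(\<Sum>s\<in>Pow {..<Suc n}. \<Sum>i<Suc n. rademacher i s * e n (a n i, b s)) =
          (\<Sum>s\<in>Pow {..<Suc n}. \<Sum>i<Suc n. 1)"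
      proof (intro sum.cong refl)
        fix s i assume "s \<in> Pow {..<Suc n}" "i \<in> {..<Suc n}"
        then show "rademacher i s * e n (a n i, b s) = 1"
          using e_point [of s n n i] finite_subset [of s "{..<Suc n}"] by simp
      qed
      also have "\<dots> = real (Suc n) * 2 ^ Suc n"
        by (simp only: sum_constant card_Pow finite_lessThan card_lessThan) simp
      finally show ?thesis unfolding F_sum by simp
    qed
    show "continuous_map ?Z euclideanreal (disjoint_series e c)" if "c \<longlonglongrightarrow> 0" for c
    proof (rule continuous_map_disjoint_series [OF e_cont _ _ that])
      show "\<bar>e n z\<bar> \<le> 1" if "z \<in> topspace ?Z" for n z
        using e_supp [OF that] by (metis abs_zero zero_le_one)
      show "\<exists>n. \<forall>m. m \<noteq> n \<longrightarrow> e m z = 0" if "z \<in> topspace ?Z" for z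
        using e_supp [OF that] by blast
    qed
    show "(\<lambda>n. c (Suc n)) \<longlonglongrightarrow> 0" if "c \<longlonglongrightarrow> 0" for c :: "nat \<Rightarrow> real"
      using that by (rule LIMSEQ_Suc)
    show "case_nat t c \<longlonglongrightarrow> 0" if "c \<longlonglongrightarrow> 0" for c :: "nat \<Rightarrow> real" and t
      by (rule LIMSEQ_imp_Suc) (use that in simp)
    show "(\<lambda>n. \<Sum>z\<in>F n. w n z * f z) \<longlonglongrightarrow> 0" if f: "continuous_map ?Z euclideanreal f" for f
    proof -
      obtain C where "\<And>z. z \<in> topspace ?Z \<Longrightarrow> \<bar>f z\<bar> \<le> C"
        using no_discrete_sequence_imp_bounded [OF none f] by blast
      then have C: "\<bar>f (u, v)\<bar> \<le> C" if "u \<in> topspace X" "v \<in> topspace Y" for u v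
        using that by simp
      have "topspace Y \<noteq> {}" using bY by blast
      then show ?thesis
        unfolding F_sum
        by (intro rademacher_average_tendsto_0 [where f = f and A = "topspace X" and B = "topspace Y" and C = C]
            C aX bY no_discrete_sequence_imp_totally_bounded [OF none f])
    qed
  qed
  show ?thesis by (rule linearly_homeomorphic_prod_real)
qed

theorem corollary1p9:
  fixes X :: "'a topology" and Y :: "'b topology"
  assumes "Tychonoff_space X" and "infinite (topspace X)"
    and "Tychonoff_space Y" and "infinite (topspace Y)"
  shows "linearly_homeomorphic (Cp (prod_topology X Y))
           (tvs_prod (Cp (prod_topology X Y)) tvs_real)"
proof (cases "\<exists>G. discrete_sequence (prod_topology X Y) G")
  case True
  moreover have "completely_regular_space (prod_topology X Y)"
    using assms by (simp add: Tychonoff_space_def completely_regular_space_prod_topology)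
  ultimately show ?thesis
    using discrete_sequence_imp_linearly_homeomorphic by blast
next
  case False
  with assms show ?thesis
    by (intro no_discrete_sequence_imp_linearly_homeomorphic) (auto simp: Tychonoff_space_def)
qed

end
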